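(* Let $n\ge2$. If $A=[a_{ij}]\in M_n$ is a strictly diagonally dominant nonsingular $M$-matrix, then for every $t=1,2,\ldots$, $$\tau(A)\geq \frac{1}{\max\limits_{i\in N}\Big\{\Big(1+\sum\limits_{k\neq i}p_{ki}^{(t)}\Big)\phi_i^{(t)}\Big\}}.$$
   Context: Let $N=\{1,\ldots,n\}$, $n\ge2$. All indices range over $N$. A matrix is called nonnegative ($\ge 0$) if all its entries are nonnegative. A matrix $A=[a_{ij}]\in\mathbb{R}^{n\times n}$ is a nonsingular $M$-matrix if $a_{ij}\le 0$ for all $i\ne j$ and $A$ is invertible with $A^{-1}\ge 0$; $M_n$ denotes the set of all $n\times n$ nonsingular $M$-matrices. For $A\in M_n$, $\tau(A)=\rho(A^{-1})^{-1}$, where $\rho$ denotes the spectral radius (the minimum eigenvalue of $A$; equivalently $\tau(A)=\min\{|\lambda|:\lambda\in\sigma(A)\}$). $A$ is strictly diagonally dominant if $\sum_{j\ne i}|a_{ij}|<|a_{ii}|$ for all $i\in N$. For $A=[a_{ij}]$ with $a_{ii}\ne0$, for $i,j\in N$, $j\ne i$, and $t=1,2,\ldots$, define $$r_i=\max_{j\neq i}\frac{|a_{ji}|}{|a_{jj}|-\sum_{k\ne j,i}|a_{jk}|},\qquad m_{ji}=\frac{|a_{ji}|+\sum_{k\ne j,i}|a_{jk}|r_i}{|a_{jj}|},$$ $$h_i=\max_{j\ne i}\frac{|a_{ji}|}{|a_{jj}|m_{ji}-\sum_{k\ne j,i}|a_{jk}|m_{ki}},\qquad u_{ji}=\frac{|a_{ji}|+\sum_{k\ne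 j,i}|a_{jk}|m_{ki}h_i}{|a_{jj}|},\qquad u^{(0)}_{ji}=u_{ji},$$ and recursively $$p^{(t)}_{ji}=\frac{|a_{ji}|+\sum_{k\ne j,i}|a_{jk}|u^{(t-1)}_{ki}}{|a_{jj}|},\qquad h^{(t)}_i=\max_{j\ne i}\frac{|a_{ji}|}{|a_{jj}|p^{(t)}_{ji}-\sum_{k\ne j,i}|a_{jk}|p^{(t)}_{ki}},\qquad u^{(t)}_{ji}=\frac{|a_{ji}|+\sum_{k\ne j,i}|a_{jk}|p^{(t)}_{ki}h^{(t)}_i}{|a_{jj}|}.$$ Finally, $$\phi_i^{(t)}=\frac{1}{a_{ii}-\sum_{j\ne i}|a_{ij}|p^{(t)}_{ji}}.$$ *)

theory Defs
  imports "Jordan_Normal_Form.Spectral_Radius" "Jordan_Normal_Form.Gauss_Jordan_Elimination"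
begin

text \<open>
  The index set is \<open>{0..<n}\<close> throughout. The division convention \<open>x / 0 = 0\<close> matters only
  for the quotients in \<open>h_coeff\<close>: for a strictly diagonally dominant M-matrix a denominator
  there can vanish only together with its numerator (e.g. when all off-diagonal entries of
  column \<open>i\<close> are zero), so that the convention amounts to reading 0/0 as 0.
\<close>

definition inverse_mat :: "'a::field mat \<Rightarrow> 'a mat" where
  "inverse_mat A = the (mat_inverse A)"

definition nonneg_mat :: "real mat \<Rightarrow> bool" where
  "nonneg_mat A \<longleftrightarrow> (\<forall>i<dim_row A. \<forall>j<dim_col A. A $$ (i, j) \<ge> 0)"

definition nonsingular_M_matrices :: "nat \<Rightarrow> real mat set" where
  "nonsingular_M_matrices n =
     {A \<in> carrier_mat n n.
        (\<forall>i<n. \<forall>j<n. i \<noteq> j \<longrightarrow> A $$ (i, j) \<le> 0) \<and>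
        invertible_mat A \<and> nonneg_mat (inverse_mat A)}"

definition tau :: "real mat \<Rightarrow> real" where
  "tau A = inverse (spectral_radius (map_mat complex_of_real (inverse_mat A)))"

definition strictly_diagonally_dominant :: "real mat \<Rightarrow> bool" where
  "strictly_diagonally_dominant A \<longleftrightarrow>
     (\<forall>i<dim_row A. (\<Sum>j\<in>{0..<dim_row A} - {i}. \<bar>A $$ (i, j)\<bar>) < \<bar>A $$ (i, i)\<bar>)"

text \<open>
  Doubly indexed quantities \<open>m\<^sub>j\<^sub>i\<close>, \<open>u\<^sub>j\<^sub>i\<close>, \<open>p\<^sub>j\<^sub>i\<close> take their arguments in the order \<open>j\<close>, \<open>i\<close>.
\<close>

definition r_coeff :: "real mat \<Rightarrow> nat \<Rightarrow> real" where
  "r_coeff A i = Max ((\<lambda>j. \<bar>A $$ (j, i)\<bar> /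
       (\<bar>A $$ (j, j)\<bar> - (\<Sum>k\<in>{0..<dim_row A} - {j, i}. \<bar>A $$ (j, k)\<bar>)))
     ` ({0..<dim_row A} - {i}))"

definition m_coeff :: "real mat \<Rightarrow> nat \<Rightarrow> nat \<Rightarrow> real" where
  "m_coeff A j i =
     (\<bar>A $$ (j, i)\<bar> + (\<Sum>k\<in>{0..<dim_row A} - {j, i}. \<bar>A $$ (j, k)\<bar> * r_coeff A i)) / \<bar>A $$ (j, j)\<bar>"

text \<open>
  The passage from \<open>m\<close> to \<open>h\<close> and \<open>u\<close> has the same form as the passage from \<open>p\<^sup>(\<^sup>t\<^sup>)\<close> to \<open>h\<^sup>(\<^sup>t\<^sup>)\<close> and
  \<open>u\<^sup>(\<^sup>t\<^sup>)\<close>; the argument \<open>v\<close> below stands for \<open>m\<close> or \<open>p\<^sup>(\<^sup>t\<^sup>)\<close>.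
\<close>

definition h_coeff :: "real mat \<Rightarrow> (nat \<Rightarrow> nat \<Rightarrow> real) \<Rightarrow> nat \<Rightarrow> real" where
  "h_coeff A v i = Max ((\<lambda>j. \<bar>A $$ (j, i)\<bar> /
       (\<bar>A $$ (j, j)\<bar> * v j i - (\<Sum>k\<in>{0..<dim_row A} - {j, i}. \<bar>A $$ (j, k)\<bar> * v k i)))
     ` ({0..<dim_row A} - {i}))"

definition u_coeff :: "real mat \<Rightarrow> (nat \<Rightarrow> nat \<Rightarrow> real) \<Rightarrow> nat \<Rightarrow> nat \<Rightarrow> real" where
  "u_coeff A v j i =
     (\<bar>A $$ (j, i)\<bar> + (\<Sum>k\<in>{0..<dim_row A} - {j, i}. \<bar>A $$ (j, k)\<bar> * v k i * h_coeff A v i))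
       / \<bar>A $$ (j, j)\<bar>"

definition p_coeff :: "real mat \<Rightarrow> (nat \<Rightarrow> nat \<Rightarrow> real) \<Rightarrow> nat \<Rightarrow> nat \<Rightarrow> real" where
  "p_coeff A u j i =
     (\<bar>A $$ (j, i)\<bar> + (\<Sum>k\<in>{0..<dim_row A} - {j, i}. \<bar>A $$ (j, k)\<bar> * u k i)) / \<bar>A $$ (j, j)\<bar>"

primrec u_iter :: "real mat \<Rightarrow> nat \<Rightarrow> nat \<Rightarrow> nat \<Rightarrow> real" where
  "u_iter A 0 = u_coeff A (m_coeff A)"
| "u_iter A (Suc t) = u_coeff A (p_coeff A (u_iter A t))"

text \<open>Only meaningful for \<open>t \<ge> 1\<close>.\<close>

definition p_iter :: "real mat \<Rightarrow> nat \<Rightarrow> nat \<Rightarrow> nat \<Rightarrow> real" where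
  "p_iter A t = p_coeff A (u_iter A (t - 1))"

definition phi :: "real mat \<Rightarrow> nat \<Rightarrow> nat \<Rightarrow> real" where
  "phi A t i =
     1 / (A $$ (i, i) - (\<Sum>j\<in>{0..<dim_row A} - {i}. \<bar>A $$ (i, j)\<bar> * p_iter A t j i))"

end

theory Submission
  imports Defs
begin

text \<open>
  Let \<open>B\<close> be the inverse of \<open>A\<close> and fix a column \<open>i\<close>. Off the row \<open>i\<close>, the identity \<open>A B = 1\<close> says
  that the ratios \<open>x\<^sub>j = b\<^sub>j\<^sub>i / b\<^sub>i\<^sub>i\<close> solve the linear system
  \<open>|a\<^sub>j\<^sub>j| x\<^sub>j = |a\<^sub>j\<^sub>i| + (\<Sum>k\<noteq>j,i. |a\<^sub>j\<^sub>k| x\<^sub>k)\<close>, that is, they are the fixed point of the Jacobi map of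
  this system. Because \<open>A\<close> is strictly diagonally dominant, the system obeys a maximum principle
  (\<open>subsolution_le_supersolution\<close>): a vector that the Jacobi map decreases lies above the fixed point.

  The coefficients \<open>r\<close>, \<open>m\<close>, \<open>u\<close>, \<open>p\<close> are all vectors of this kind. The constant vector
  \<open>r\<^sub>i\<close> is the least constant one; \<open>m\<close> and \<open>p\<close> arise by one Jacobi step, which is monotone and so
  preserves the property; and \<open>h\<^sub>i\<close> is the scaling factor by which such a vector can be
  shrunk without losing it. Hence \<open>b\<^sub>j\<^sub>i \<le> p\<^sub>j\<^sub>i b\<^sub>i\<^sub>i\<close>, with all \<open>p\<^sub>j\<^sub>i \<le> 1\<close> (\<open>supersolution_p_iter\<close>).

  Inserted into row \<open>i\<close> of \<open>A B = 1\<close>, this estimate gives \<open>b\<^sub>i\<^sub>i \<le> \<phi>\<^sub>i\<close>; so the sum of the \<open>i\<close>-th column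
  of \<open>B\<close> is at most \<open>(1 + (\<Sum>k\<noteq>i. p\<^sub>k\<^sub>i)) \<phi>\<^sub>i\<close>. The spectral radius of \<open>B\<close> is at most its greatest
  column sum, and it is positive since \<open>B\<close> is invertible; taking reciprocals yields the bound.
\<close>

section \<open>Supersolutions of the Jacobi system of a column\<close>

text \<open>
  The vector on the rows other than \<open>i\<close> is the column \<open>i\<close> of a doubly indexed \<open>v\<close>, so that
  the coefficient families can be substituted for \<open>v\<close> directly. The bound by \<open>1\<close> keeps the
  denominator of \<open>\<phi>\<^sub>i\<close> positive.
\<close>

definition supersolution :: "real mat \<Rightarrow> nat \<Rightarrow> (nat \<Rightarrow> nat \<Rightarrow> real) \<Rightarrow> bool" where
  "supersolution A i v \<longleftrightarrow> (\<forall>j\<in>{0..<dim_row A} - {i}.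
     \<bar>A $$ (j, i)\<bar> + (\<Sum>k\<in>{0..<dim_row A} - {j, i}. \<bar>A $$ (j, k)\<bar> * v k i) \<le> \<bar>A $$ (j, j)\<bar> * v j i
     \<and> v j i \<le> 1)"

lemma diagonal_nonzero:
  assumes "strictly_diagonally_dominant A" "j < dim_row A"
  shows "\<bar>A $$ (j, j)\<bar> > 0"
proof -
  have "0 \<le> (\<Sum>k\<in>{0..<dim_row A} - {j}. \<bar>A $$ (j, k)\<bar>)" by (rule sum_nonneg) simp
  also have "\<dots> < \<bar>A $$ (j, j)\<bar>"
    using assms unfolding strictly_diagonally_dominant_def by blast
  finally show ?thesis .
qed

lemma dominance_off_column:
  assumes "strictly_diagonally_dominant A" "j < dim_row A" "i < dim_row A" "j \<noteq> i"
  shows "\<bar>A $$ (j, i)\<bar> + (\<Sum>k\<in>{0..<dim_row A} - {j, i}. \<bar>A $$ (j, k)\<bar>) < \<bar>A $$ (j, j)\<bar>"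
proof -
  have eq: "{0..<dim_row A} - {j} - {i} = {0..<dim_row A} - {j, i}" by auto
  have "(\<Sum>k\<in>{0..<dim_row A} - {j}. \<bar>A $$ (j, k)\<bar>)
      = \<bar>A $$ (j, i)\<bar> + (\<Sum>k\<in>{0..<dim_row A} - {j, i}. \<bar>A $$ (j, k)\<bar>)"
    using assms by (subst sum.remove[where x = i]) (auto simp: eq)
  then show ?thesis
    using assms unfolding strictly_diagonally_dominant_def by metis
qed

text \<open>
  At a row where the excess \<open>x - v\<close> is maximal, the two systems bound \<open>|a\<^sub>j\<^sub>j|\<close> times a positive
  maximum by the off-diagonal row sum times the same maximum, against strict dominance.
\<close>

lemma subsolution_le_supersolution:
  assumes sdd: "strictly_diagonally_dominant A" and i: "i < dim_row A"
    and v: "supersolution A i v"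
    and x: "\<And>j. j < dim_row A \<Longrightarrow> j \<noteq> i \<Longrightarrow> \<bar>A $$ (j, j)\<bar> * x j
        \<le> \<bar>A $$ (j, i)\<bar> + (\<Sum>k\<in>{0..<dim_row A} - {j, i}. \<bar>A $$ (j, k)\<bar> * x k)"
    and j: "j < dim_row A" "j \<noteq> i"
  shows "x j \<le> v j i"
proof (rule ccontr)
  assume neg: "\<not> x j \<le> v j i"
  define N where "N = {0..<dim_row A} - {i}"
  have N: "finite N" "N \<noteq> {}" using j by (auto simp: N_def)
  define d where "d k = x k - v k i" for k
  define D where "D = Max (d ` N)"
  have le: "d k \<le> D" if "k \<in> N" for k using N that by (auto simp: D_def)
  have "D \<in> d ` N" unfolding D_def using N by (intro Max_in) auto
  then obtain l where l: "l \<in> N" "d l = D" by auto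
  have pos: "D > 0" using le[of j] neg j by (auto simp: d_def N_def)
  have l': "l < dim_row A" "l \<noteq> i" using l by (auto simp: N_def)
  let ?R = "{0..<dim_row A} - {l, i}"
  have "\<bar>A $$ (l, l)\<bar> * D = \<bar>A $$ (l, l)\<bar> * x l - \<bar>A $$ (l, l)\<bar> * v l i"
    using l(2) by (simp add: d_def flip: right_diff_distrib)
  also have "\<dots> \<le> (\<Sum>k\<in>?R. \<bar>A $$ (l, k)\<bar> * x k) - (\<Sum>k\<in>?R. \<bar>A $$ (l, k)\<bar> * v k i)"
    using x[OF l'] v l' unfolding supersolution_def by force
  also have "\<dots> = (\<Sum>k\<in>?R. \<bar>A $$ (l, k)\<bar> * d k)"
    by (simp add: d_def right_diff_distrib sum_subtractf)
  also have "\<dots> \<le> (\<Sum>k\<in>?R. \<bar>A $$ (l, k)\<bar> * D)"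
    by (intro sum_mono mult_left_mono le) (auto simp: N_def)
  also have "\<dots> = (\<Sum>k\<in>?R. \<bar>A $$ (l, k)\<bar>) * D" by (simp add: sum_distrib_right)
  also have "\<dots> < \<bar>A $$ (l, l)\<bar> * D"
    using dominance_off_column[OF sdd l'(1) i l'(2)] pos by (intro mult_strict_right_mono) linarith+
  finally show False by simp
qed

lemma supersolution_nonneg:
  assumes "strictly_diagonally_dominant A" "i < dim_row A" "supersolution A i v"
    and "j < dim_row A" "j \<noteq> i"
  shows "0 \<le> v j i"
  using subsolution_le_supersolution[OF assms(1-3), of "\<lambda>_. 0"] assms(4,5) by simp

text \<open>A Jacobi step decreases a supersolution, and it is monotone, so the result is decreased again.\<close>

lemma supersolution_p_coeff:
  assumes sdd: "strictly_diagonally_dominant A" and v: "supersolution A i v"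
  shows "supersolution A i (p_coeff A v)"
proof -
  have step: "\<bar>A $$ (j, j)\<bar> * p_coeff A v j i
      = \<bar>A $$ (j, i)\<bar> + (\<Sum>k\<in>{0..<dim_row A} - {j, i}. \<bar>A $$ (j, k)\<bar> * v k i)"
    if "j < dim_row A" for j
    using diagonal_nonzero[OF sdd that] by (simp add: p_coeff_def)
  have le: "p_coeff A v j i \<le> v j i" if j: "j < dim_row A" "j \<noteq> i" for j
  proof -
    have "\<bar>A $$ (j, j)\<bar> * p_coeff A v j i \<le> \<bar>A $$ (j, j)\<bar> * v j i"
      using step[OF j(1)] v j unfolding supersolution_def by simp
    then show ?thesis using diagonal_nonzero[OF sdd j(1)] mult_le_cancel_left_pos by blast
  qed
  show ?thesis
    unfolding supersolution_def
  proof (intro ballI conjI)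
    fix j assume "j \<in> {0..<dim_row A} - {i}"
    then have j: "j < dim_row A" "j \<noteq> i" by auto
    have "(\<Sum>k\<in>{0..<dim_row A} - {j, i}. \<bar>A $$ (j, k)\<bar> * p_coeff A v k i)
        \<le> (\<Sum>k\<in>{0..<dim_row A} - {j, i}. \<bar>A $$ (j, k)\<bar> * v k i)"
      by (intro sum_mono mult_left_mono le) auto
    then show "\<bar>A $$ (j, i)\<bar> + (\<Sum>k\<in>{0..<dim_row A} - {j, i}. \<bar>A $$ (j, k)\<bar> * p_coeff A v k i)
        \<le> \<bar>A $$ (j, j)\<bar> * p_coeff A v j i"
      unfolding step[OF j(1)] by simp
    show "p_coeff A v j i \<le> 1" using le[OF j] v j unfolding supersolution_def by force
  qed
qed

section \<open>The coefficient families are supersolutions\<close>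

lemma supersolution_r_coeff:
  assumes sdd: "strictly_diagonally_dominant A" and i: "i < dim_row A"
  shows "supersolution A i (\<lambda>_. r_coeff A)"
  unfolding supersolution_def
proof (intro ballI conjI)
  let ?s = "\<lambda>j. \<Sum>k\<in>{0..<dim_row A} - {j, i}. \<bar>A $$ (j, k)\<bar>"
  let ?q = "\<lambda>j. \<bar>A $$ (j, i)\<bar> / (\<bar>A $$ (j, j)\<bar> - ?s j)"
  have dom: "\<bar>A $$ (j, i)\<bar> + ?s j < \<bar>A $$ (j, j)\<bar>" if "j \<in> {0..<dim_row A} - {i}" for j
    using dominance_off_column[OF sdd _ i, of j] that by auto
  fix j assume j: "j \<in> {0..<dim_row A} - {i}"
  have "?q j \<le> r_coeff A i" unfolding r_coeff_def using j by (intro Max_ge) auto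
  then have "\<bar>A $$ (j, i)\<bar> \<le> r_coeff A i * (\<bar>A $$ (j, j)\<bar> - ?s j)"
    using dom[OF j] by (simp add: pos_divide_le_eq)
  then show "\<bar>A $$ (j, i)\<bar> + (\<Sum>k\<in>{0..<dim_row A} - {j, i}. \<bar>A $$ (j, k)\<bar> * r_coeff A i)
      \<le> \<bar>A $$ (j, j)\<bar> * r_coeff A i"
    by (simp add: algebra_simps flip: sum_distrib_left)
  have "?q l \<le> 1" if "l \<in> {0..<dim_row A} - {i}" for l
    using dom[OF that] by (simp add: pos_divide_le_eq)
  then show "r_coeff A i \<le> 1" unfolding r_coeff_def using j by (subst Max_le_iff) auto
qed

text \<open>
  A supersolution has every numerator in \<open>h\<^sub>i\<close> bounded by its denominator. Hence \<open>h\<^sub>i \<le> 1\<close>, and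
  a vanishing denominator forces the numerator to vanish, so that the inequality demanded of the
  scaled vector holds in that row as well.
\<close>

lemma supersolution_scale_h_coeff:
  assumes sdd: "strictly_diagonally_dominant A" and i: "i < dim_row A"
    and v: "supersolution A i v"
  shows "supersolution A i (\<lambda>k l. v k l * h_coeff A v l)"
  unfolding supersolution_def
proof (intro ballI conjI)
  let ?s = "\<lambda>j. \<Sum>k\<in>{0..<dim_row A} - {j, i}. \<bar>A $$ (j, k)\<bar> * v k i"
  let ?d = "\<lambda>j. \<bar>A $$ (j, j)\<bar> * v j i - ?s j"
  let ?q = "\<lambda>j. \<bar>A $$ (j, i)\<bar> / ?d j"
  let ?h = "h_coeff A v i"
  have num_le: "\<bar>A $$ (j, i)\<bar> \<le> ?d j" if "j \<in> {0..<dim_row A} - {i}" for j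
    using v that unfolding supersolution_def by force
  fix j assume j: "j \<in> {0..<dim_row A} - {i}"
  have q: "?q j \<le> ?h" unfolding h_coeff_def using j by (intro Max_ge) auto
  have "\<bar>A $$ (j, i)\<bar> \<le> ?h * ?d j"
  proof (cases "?d j = 0")
    case True
    then show ?thesis using num_le[OF j] by simp
  next
    case False
    then have "?d j > 0" using num_le[OF j] abs_ge_zero[of "A $$ (j, i)"] by linarith
    then show ?thesis using q by (simp add: pos_divide_le_eq)
  qed
  moreover have "(\<Sum>k\<in>{0..<dim_row A} - {j, i}. \<bar>A $$ (j, k)\<bar> * (v k i * ?h)) = ?h * ?s j"
    by (simp add: sum_distrib_left mult_ac)
  ultimately show "\<bar>A $$ (j, i)\<bar>
      + (\<Sum>k\<in>{0..<dim_row A} - {j, i}. \<bar>A $$ (j, k)\<bar> * (v k i * ?h)) \<le> \<bar>A $$ (j, j)\<bar> * (v j i * ?h)"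
    by (simp add: algebra_simps)
  have "?q l \<le> 1" if "l \<in> {0..<dim_row A} - {i}" for l
  proof -
    have "?d l \<ge> 0" using num_le[OF that] abs_ge_zero[of "A $$ (l, i)"] by linarith
    then show ?thesis using num_le[OF that] by (auto simp only: divide_le_eq_1)
  qed
  then have "?h \<le> 1" unfolding h_coeff_def using j by (subst Max_le_iff) auto
  moreover have "0 \<le> v j i" using supersolution_nonneg[OF sdd i v] j by auto
  moreover have "v j i \<le> 1" using v j unfolding supersolution_def by blast
  ultimately show "v j i * ?h \<le> 1"
    using mult_left_mono[of ?h 1 "v j i"] by linarith
qed

lemma supersolution_u_coeff:
  assumes "strictly_diagonally_dominant A" "i < dim_row A" "supersolution A i v"
  shows "supersolution A i (u_coeff A v)"
proof -
  have "u_coeff A v = p_coeff A (\<lambda>k l. v k l * h_coeff A v l)"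
    by (intro ext) (simp add: u_coeff_def p_coeff_def mult.assoc)
  then show ?thesis
    using supersolution_p_coeff[OF assms(1) supersolution_scale_h_coeff[OF assms]] by simp
qed

lemma supersolution_u_iter:
  assumes sdd: "strictly_diagonally_dominant A" and i: "i < dim_row A"
  shows "supersolution A i (u_iter A t)"
proof (induction t)
  case 0
  have "m_coeff A = p_coeff A (\<lambda>_. r_coeff A)"
    by (intro ext) (simp add: m_coeff_def p_coeff_def)
  then have "supersolution A i (m_coeff A)"
    using supersolution_p_coeff[OF sdd supersolution_r_coeff[OF sdd i]] by simp
  then show ?case using supersolution_u_coeff[OF sdd i] by simp
next
  case (Suc t)
  then show ?case
    using supersolution_u_coeff[OF sdd i supersolution_p_coeff[OF sdd]] by simp
qed

lemma supersolution_p_iter: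
  assumes "strictly_diagonally_dominant A" "i < dim_row A"
  shows "supersolution A i (p_iter A t)"
  unfolding p_iter_def by (intro supersolution_p_coeff supersolution_u_iter assms)

section \<open>Column sums of the inverse\<close>

lemma inverse_mat_right:
  fixes A :: "'a::field mat"
  assumes A: "A \<in> carrier_mat n n" and inv: "invertible_mat A"
  shows "inverse_mat A \<in> carrier_mat n n" "A * inverse_mat A = 1\<^sub>m n"
proof -
  obtain C where C: "inverts_mat A C" "inverts_mat C A"
    using inv unfolding invertible_mat_def by blast
  have "dim_row C = n"
    using C(2) A unfolding inverts_mat_def
    by (metis carrier_matD(2) index_mult_mat(3) index_one_mat(3))
  moreover have "dim_col C = n"
    using C(1) A unfolding inverts_mat_def
    by (metis carrier_matD(1) index_mult_mat(3) index_one_mat(3))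
  ultimately have "C \<in> carrier_mat n n" "A * C = 1\<^sub>m n" "C * A = 1\<^sub>m n"
    using C A unfolding inverts_mat_def by auto
  then have "A \<in> Units (ring_mat TYPE('a) n undefined)"
    using A unfolding Units_def ring_mat_def by auto
  then obtain B where B: "mat_inverse A = Some B"
    using mat_inverse(1)[OF A, of undefined] by (cases "mat_inverse A") auto
  from mat_inverse(2)[OF A B] B
  show "inverse_mat A \<in> carrier_mat n n" "A * inverse_mat A = 1\<^sub>m n"
    by (auto simp: inverse_mat_def)
qed

text \<open>
  Since the off-diagonal entries of \<open>A\<close> are nonpositive, moving them to the other side of
  \<open>A B = 1\<close> turns them into absolute values.
\<close>

lemma right_inverse_entry:
  fixes A B :: "real mat"
  assumes A: "A \<in> carrier_mat n n" and B: "B \<in> carrier_mat n n" and AB: "A * B = 1\<^sub>m n"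
    and off: "\<forall>i<n. \<forall>j<n. i \<noteq> j \<longrightarrow> A $$ (i, j) \<le> 0"
    and ij: "i < n" "j < n"
  shows "A $$ (j, j) * B $$ (j, i)
     = (if j = i then 1 else 0) + (\<Sum>k\<in>{0..<n} - {j}. \<bar>A $$ (j, k)\<bar> * B $$ (k, i))"
proof -
  have "(if j = i then 1 else 0) = (A * B) $$ (j, i)" using ij by (simp add: AB)
  also have "\<dots> = (\<Sum>k\<in>{0..<n}. A $$ (j, k) * B $$ (k, i))"
    using A B ij by (simp add: scalar_prod_def)
  also have "\<dots> = A $$ (j, j) * B $$ (j, i) + (\<Sum>k\<in>{0..<n} - {j}. A $$ (j, k) * B $$ (k, i))"
    using ij by (subst sum.remove[where x = j]) auto
  also have "(\<Sum>k\<in>{0..<n} - {j}. A $$ (j, k) * B $$ (k, i))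
      = (\<Sum>k\<in>{0..<n} - {j}. - (\<bar>A $$ (j, k)\<bar> * B $$ (k, i)))"
    by (intro sum.cong refl) (use off ij in force)
  finally show ?thesis by (simp add: sum_negf)
qed

lemma inverse_column_sum_le:
  fixes A B :: "real mat"
  assumes A: "A \<in> carrier_mat n n" and B: "B \<in> carrier_mat n n" and AB: "A * B = 1\<^sub>m n"
    and off: "\<forall>i<n. \<forall>j<n. i \<noteq> j \<longrightarrow> A $$ (i, j) \<le> 0"
    and nonneg: "\<forall>i<n. \<forall>j<n. 0 \<le> B $$ (i, j)"
    and sdd: "strictly_diagonally_dominant A" and i: "i < n"
  shows "(\<Sum>k\<in>{0..<n}. B $$ (k, i)) \<le> (1 + (\<Sum>k\<in>{0..<n} - {i}. p_iter A t k i)) * phi A t i"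
proof -
  have B0: "0 \<le> B $$ (i, j)" if "i < n" "j < n" for i j using nonneg that by blast
  note entry = right_inverse_entry[OF A B AB off]
  have dim: "dim_row A = n" using A by simp
  let ?p = "\<lambda>k. p_iter A t k i"
  have super: "supersolution A i (p_iter A t)" using supersolution_p_iter[OF sdd] i dim by simp
  have pos: "A $$ (j, j) > 0 \<and> B $$ (j, j) > 0" if j: "j < n" for j
  proof -
    have "(\<Sum>k\<in>{0..<n} - {j}. \<bar>A $$ (j, k)\<bar> * B $$ (k, j)) \<ge> 0"
      using B0 j by (intro sum_nonneg) auto
    then have "A $$ (j, j) * B $$ (j, j) > 0" using entry[OF j j] by simp
    then show ?thesis using B0[OF j j] by (auto simp: zero_less_mult_iff)
  qed
  let ?x = "\<lambda>k. B $$ (k, i) / B $$ (i, i)"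
  have ratio: "?x j \<le> ?p j" if j: "j < n" "j \<noteq> i" for j
  proof (rule subsolution_le_supersolution[OF sdd _ super])
    fix l assume l: "l < dim_row A" "l \<noteq> i"
    let ?s = "\<Sum>k\<in>{0..<n} - {l, i}. \<bar>A $$ (l, k)\<bar> * B $$ (k, i)"
    have eq: "{0..<n} - {l} - {i} = {0..<n} - {l, i}" by auto
    have "A $$ (l, l) * B $$ (l, i) = \<bar>A $$ (l, i)\<bar> * B $$ (i, i) + ?s"
      using entry[OF i, of l] l i dim by (simp add: sum.remove[where x = i] eq)
    then have "A $$ (l, l) * B $$ (l, i) / B $$ (i, i) = \<bar>A $$ (l, i)\<bar> + ?s / B $$ (i, i)"
      using pos[OF i] by (simp add: field_simps)
    then show "\<bar>A $$ (l, l)\<bar> * ?x l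
        \<le> \<bar>A $$ (l, i)\<bar> + (\<Sum>k\<in>{0..<dim_row A} - {l, i}. \<bar>A $$ (l, k)\<bar> * ?x k)"
      using pos[of l] l dim by (simp add: sum_divide_distrib)
  qed (use i j dim in auto)
  have col: "B $$ (j, i) \<le> ?p j * B $$ (i, i)" if j: "j < n" "j \<noteq> i" for j
    using ratio[OF j] pos[OF i] by (simp add: pos_divide_le_eq)
  let ?t = "\<Sum>j\<in>{0..<n} - {i}. \<bar>A $$ (i, j)\<bar> * ?p j"
  have "?t \<le> (\<Sum>j\<in>{0..<n} - {i}. \<bar>A $$ (i, j)\<bar> * 1)"
    using super dim unfolding supersolution_def by (intro sum_mono mult_left_mono) auto
  also have "\<dots> < A $$ (i, i)"
    using sdd i dim pos[OF i] unfolding strictly_diagonally_dominant_def by auto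
  finally have den: "0 < A $$ (i, i) - ?t" by simp
  have "A $$ (i, i) * B $$ (i, i) = 1 + (\<Sum>j\<in>{0..<n} - {i}. \<bar>A $$ (i, j)\<bar> * B $$ (j, i))"
    using entry[OF i i] by simp
  also have "\<dots> \<le> 1 + (\<Sum>j\<in>{0..<n} - {i}. \<bar>A $$ (i, j)\<bar> * (?p j * B $$ (i, i)))"
    using col by (intro add_left_mono sum_mono mult_left_mono) auto
  also have "\<dots> = 1 + ?t * B $$ (i, i)" by (simp add: sum_distrib_right mult.assoc)
  finally have "B $$ (i, i) * (A $$ (i, i) - ?t) \<le> 1" by (simp add: algebra_simps)
  then have diag: "B $$ (i, i) \<le> phi A t i"
    using den by (simp add: phi_def dim pos_le_divide_eq)
  have "(\<Sum>k\<in>{0..<n}. B $$ (k, i)) = B $$ (i, i) + (\<Sum>k\<in>{0..<n} - {i}. B $$ (k, i))"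
    using i by (subst sum.remove[where x = i]) auto
  also have "\<dots> \<le> B $$ (i, i) + (\<Sum>k\<in>{0..<n} - {i}. ?p k * B $$ (i, i))"
    using col by (intro add_left_mono sum_mono) auto
  also have "\<dots> = (1 + (\<Sum>k\<in>{0..<n} - {i}. ?p k)) * B $$ (i, i)"
    by (simp add: algebra_simps sum_distrib_left)
  also have "\<dots> \<le> (1 + (\<Sum>k\<in>{0..<n} - {i}. ?p k)) * phi A t i"
  proof (rule mult_left_mono[OF diag])
    have "(\<Sum>k\<in>{0..<n} - {i}. ?p k) \<ge> 0"
      using supersolution_nonneg[OF sdd _ super] i dim by (intro sum_nonneg) auto
    then show "0 \<le> 1 + (\<Sum>k\<in>{0..<n} - {i}. ?p k)" by simp
  qed
  finally show ?thesis .
qed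

section \<open>The spectral radius\<close>

text \<open>
  Compare the \<open>1\<close>-norms of both sides of \<open>C v = \<lambda> v\<close> for an eigenvector \<open>v\<close>.
\<close>

lemma eigenvalue_norm_le_column_sum:
  fixes C :: "complex mat"
  assumes C: "C \<in> carrier_mat n n" and ev: "eigenvalue C l"
    and M: "\<And>k. k < n \<Longrightarrow> (\<Sum>j\<in>{0..<n}. cmod (C $$ (j, k))) \<le> M"
  shows "cmod l \<le> M"
proof -
  obtain v where v: "v \<in> carrier_vec n" "v \<noteq> 0\<^sub>v n" "C *\<^sub>v v = l \<cdot>\<^sub>v v"
    using ev C unfolding eigenvalue_def eigenvector_def by auto
  let ?S = "\<Sum>k\<in>{0..<n}. cmod (v $ k)"
  obtain k where k: "k < n" "v $ k \<noteq> 0" using v(1,2) by (metis carrier_vecD eq_vecI index_zero_vec)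
  then have "0 < cmod (v $ k)" by simp
  also have "\<dots> \<le> ?S" using k by (intro member_le_sum) auto
  finally have pos: "0 < ?S" .
  have row: "cmod l * cmod (v $ j) \<le> (\<Sum>k\<in>{0..<n}. cmod (C $$ (j, k)) * cmod (v $ k))"
    if "j < n" for j
  proof -
    have "l * v $ j = (C *\<^sub>v v) $ j" using v that by simp
    also have "\<dots> = (\<Sum>k\<in>{0..<n}. C $$ (j, k) * v $ k)"
      using C v(1) that by (simp add: scalar_prod_def)
    finally have "cmod l * cmod (v $ j) = cmod (\<Sum>k\<in>{0..<n}. C $$ (j, k) * v $ k)"
      by (metis norm_mult)
    also have "\<dots> \<le> (\<Sum>k\<in>{0..<n}. cmod (C $$ (j, k)) * cmod (v $ k))"
      by (rule order_trans[OF norm_sum]) (simp add: norm_mult)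
    finally show ?thesis .
  qed
  have "cmod l * ?S = (\<Sum>j\<in>{0..<n}. cmod l * cmod (v $ j))" by (simp add: sum_distrib_left)
  also have "\<dots> \<le> (\<Sum>j\<in>{0..<n}. \<Sum>k\<in>{0..<n}. cmod (C $$ (j, k)) * cmod (v $ k))"
    by (intro sum_mono row) auto
  also have "\<dots> = (\<Sum>k\<in>{0..<n}. (\<Sum>j\<in>{0..<n}. cmod (C $$ (j, k))) * cmod (v $ k))"
    by (subst sum.swap) (simp add: sum_distrib_right)
  also have "\<dots> \<le> (\<Sum>k\<in>{0..<n}. M * cmod (v $ k))"
    using M by (intro sum_mono mult_right_mono) auto
  also have "\<dots> = M * ?S" by (simp add: sum_distrib_left)
  finally show ?thesis using pos mult_le_cancel_right_pos by blast
qed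

lemma eigenvalue_nonzero_of_left_inverse:
  fixes C D :: "'a :: field mat"
  assumes C: "C \<in> carrier_mat n n" and D: "D \<in> carrier_mat n n" and DC: "D * C = 1\<^sub>m n"
    and ev: "eigenvalue C l"
  shows "l \<noteq> 0"
proof
  assume "l = 0"
  then obtain v where v: "v \<in> carrier_vec n" "v \<noteq> 0\<^sub>v n" "C *\<^sub>v v = 0 \<cdot>\<^sub>v v"
    using ev C unfolding eigenvalue_def eigenvector_def by auto
  have "v = (D * C) *\<^sub>v v" using v(1) DC by simp
  also have "\<dots> = D *\<^sub>v (C *\<^sub>v v)" using C D v(1) by (simp add: assoc_mult_mat_vec)
  also have "C *\<^sub>v v = 0\<^sub>v n" using v by auto
  also have "D *\<^sub>v 0\<^sub>v n = 0\<^sub>v n" using D by auto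
  finally show False using v(2) by simp
qed

theorem theorem6:
  fixes n t :: nat and A :: "real mat"
  assumes "n \<ge> 2"
    and "A \<in> nonsingular_M_matrices n"
    and "strictly_diagonally_dominant A"
    and "t \<ge> 1"
  shows "tau A \<ge>
    1 / Max ((\<lambda>i. (1 + (\<Sum>k\<in>{0..<n} - {i}. p_iter A t k i)) * phi A t i) ` {0..<n})"
proof -
  let ?f = "\<lambda>i. (1 + (\<Sum>k\<in>{0..<n} - {i}. p_iter A t k i)) * phi A t i"
  let ?M = "Max (?f ` {0..<n})"
  define B where "B = inverse_mat A"
  have A: "A \<in> carrier_mat n n" and inv: "invertible_mat A"
    and off: "\<forall>i<n. \<forall>j<n. i \<noteq> j \<longrightarrow> A $$ (i, j) \<le> 0"
    using assms(2) by (auto simp: nonsingular_M_matrices_def)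
  have B: "B \<in> carrier_mat n n" and AB: "A * B = 1\<^sub>m n"
    using inverse_mat_right[OF A inv] by (simp_all add: B_def)
  have B0: "\<forall>i<n. \<forall>j<n. 0 \<le> B $$ (i, j)"
    using assms(2) B by (auto simp: nonsingular_M_matrices_def nonneg_mat_def B_def)
  let ?A = "map_mat complex_of_real A" and ?B = "map_mat complex_of_real B"
  have cA: "?A \<in> carrier_mat n n" and cB: "?B \<in> carrier_mat n n" using A B by auto
  have cAB: "?A * ?B = 1\<^sub>m n"
    by (metis AB of_real_hom.mat_hom_mult[OF A B] of_real_hom.mat_hom_one)
  have "spectral_radius ?B \<in> norm ` spectrum ?B"
    using spectral_radius_mem_max(1)[OF cB] assms(1) by simp
  then obtain l where l: "eigenvalue ?B l" "spectral_radius ?B = cmod l"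
    unfolding spectrum_def by auto
  have "(\<Sum>j\<in>{0..<n}. cmod (?B $$ (j, k))) \<le> ?M" if k: "k < n" for k
  proof -
    have "(\<Sum>j\<in>{0..<n}. cmod (?B $$ (j, k))) = (\<Sum>j\<in>{0..<n}. B $$ (j, k))"
      using B B0 k by (intro sum.cong) auto
    also have "\<dots> \<le> ?f k"
      using inverse_column_sum_le[OF A B AB off B0 assms(3) k] by simp
    also have "\<dots> \<le> ?M" using k by (intro Max_ge) auto
    finally show ?thesis .
  qed
  then have "spectral_radius ?B \<le> ?M" using eigenvalue_norm_le_column_sum[OF cB l(1)] l(2) by simp
  moreover have "spectral_radius ?B > 0"
    using eigenvalue_nonzero_of_left_inverse[OF cB cA cAB l(1)] l(2) by simp
  ultimately have "inverse ?M \<le> inverse (spectral_radius ?B)" by (rule le_imp_inverse_le)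
  then show ?thesis by (simp add: tau_def B_def inverse_eq_divide)
qed

end
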